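(* Let $f \in C^{1}(\mathbb{R})$ (with $f:\mathbb{R}\to\mathbb{R}$), and let $x^{*}\in\mathbb{R}$ satisfy $f(x^{*})=0$ and $f'(x^{*})=\lambda>0$. Let $\epsilon\in\mathbb{R}$ and $\tau>0$ verify $$\frac{-2\cosh(\lambda\tau)}{\lambda\tau}<\epsilon<\frac{-2\sinh(\lambda\tau)}{\lambda\tau}.$$ Then $x^{*}$ is an asymptotically stable equilibrium point of the controlled system $$\dot{x}(t)=f(x(t))+\epsilon(t)\,\dot{x}(t-\tau),\qquad t\ge 0,$$ where, for $k\in\mathbb{N}\cup\{0\}$, $\epsilon(t)=0$ if $2k\tau\le t<(2k+1)\tau$ and $\epsilon(t)=\epsilon$ if $(2k+1)\tau\le t<(2k+2)\tau$.
   Context: The controlled system is understood as a piecewise ordinary differential equation with initial condition $x(0)=x_0$ (no history on $[-\tau,0)$ is needed, because the delayed term is switched off on $[0,\tau)$). A solution is a continuous function $x(t)$ such that, for each $k\ge 0$: on $[2k\tau,(2k+1)\tau)$ it satisfies $\dot{x}(t)=f(x(t))$; on $[(2k+1)\tau,(2k+2)\tau)$ it satisfies $\dot{x}(t)=f(x(t))+\epsilon\,\dot{x}(t-\tau)$, where $\dot{x}(t-\tau)=f(x(t-\tau))$ is determined by the solution on the preceding subinterval $[2k\tau,(2k+1)\tau)$. Derivatives at the switching times $j\tau$ are right derivatives. The point $x^{*}$ is an equilibrium of the controlled system, i.e. $x(t)\equiv x^{*}$ is a solution. It is asymptotically stable if (i) for every $\Delta>0$ there is $\delta>0$ such that for $|x_0-x^{*}|<\delta$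 there is a unique solution with $x(0)=x_0$, it exists for all $t\ge 0$, and $|x(t)-x^{*}|<\Delta$ for all $t\ge 0$; and (ii) there is $\delta'>0$ such that $|x_0-x^{*}|<\delta'$ implies $\lim_{t\to\infty}x(t)=x^{*}$. *)

theory Defs
  imports "HOL-Analysis.Analysis"
begin

definition switched_gain :: "real \<Rightarrow> real \<Rightarrow> real \<Rightarrow> real" where
  "switched_gain \<epsilon> \<tau> t =
     (if \<exists>k::nat. 2 * real k * \<tau> \<le> t \<and> t < (2 * real k + 1) * \<tau> then 0 else \<epsilon>)"

text \<open>
  Solutions of \<open>x'(t) = f (x t) + \<epsilon>(t) * x'(t - \<tau>)\<close> on \<open>[0, T)\<close>, where \<open>T\<close> may be infinite.
  The function \<open>v\<close> is the derivative of \<open>x\<close>. It is taken within the half-open switching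
  interval containing \<open>t\<close>, hence it is two-sided at interior points and a right derivative
  at the switching times \<open>j * \<tau>\<close>. For \<open>t < \<tau>\<close> the gain is zero, so the values of \<open>v\<close> on
  negative arguments are irrelevant and no history is needed.
\<close>

definition controlled_solution ::
    "(real \<Rightarrow> real) \<Rightarrow> real \<Rightarrow> real \<Rightarrow> ereal \<Rightarrow> real \<Rightarrow> (real \<Rightarrow> real) \<Rightarrow> bool" where
  "controlled_solution f \<epsilon> \<tau> T x0 x \<longleftrightarrow>
     x 0 = x0 \<and>
     continuous_on {t. 0 \<le> t \<and> ereal t < T} x \<and>
     (\<exists>v.
       (\<forall>j::nat. \<forall>t \<in> {real j * \<tau> ..< (real j + 1) * \<tau>}. ereal t < T \<longrightarrow>
          (x has_real_derivative v t) (at t within {real j * \<tau> ..< (real j + 1) * \<tau>})) \<and>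
       (\<forall>t. 0 \<le> t \<and> ereal t < T \<longrightarrow>
          v t = f (x t) + switched_gain \<epsilon> \<tau> t * v (t - \<tau>)))"

text \<open>
  Uniqueness is required against every solution with the same initial value, including
  those defined only on a bounded interval \<open>[0, T)\<close>.
\<close>

definition unique_global_solution ::
    "(real \<Rightarrow> real) \<Rightarrow> real \<Rightarrow> real \<Rightarrow> real \<Rightarrow> (real \<Rightarrow> real) \<Rightarrow> bool" where
  "unique_global_solution f \<epsilon> \<tau> x0 x \<longleftrightarrow>
     controlled_solution f \<epsilon> \<tau> \<infinity> x0 x \<and>
     (\<forall>T y. controlled_solution f \<epsilon> \<tau> T x0 y \<longrightarrow>
        (\<forall>t. 0 \<le> t \<and> ereal t < T \<longrightarrow> y t = x t))"

definition equilibrium :: "(real \<Rightarrow> real) \<Rightarrow> real \<Rightarrow> real \<Rightarrow> real \<Rightarrow> bool" where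
  "equilibrium f \<epsilon> \<tau> xs \<longleftrightarrow> controlled_solution f \<epsilon> \<tau> \<infinity> xs (\<lambda>_. xs)"

definition asymptotically_stable :: "(real \<Rightarrow> real) \<Rightarrow> real \<Rightarrow> real \<Rightarrow> real \<Rightarrow> bool" where
  "asymptotically_stable f \<epsilon> \<tau> xs \<longleftrightarrow>
     (\<forall>\<Delta>>0. \<exists>\<delta>>0. \<forall>x0. \<bar>x0 - xs\<bar> < \<delta> \<longrightarrow>
        (\<exists>x. unique_global_solution f \<epsilon> \<tau> x0 x \<and> (\<forall>t\<ge>0. \<bar>x t - xs\<bar> < \<Delta>))) \<and>
     (\<exists>\<delta>'>0. \<forall>x0. \<bar>x0 - xs\<bar> < \<delta>' \<longrightarrow>
        (\<exists>x. unique_global_solution f \<epsilon> \<tau> x0 x \<and> (x \<longlongrightarrow> xs) at_top))"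

end

theory Submission
  imports Defs
begin

text \<open>
  Near the equilibrium the vector field is almost linear, \<open>f y = lam * (y - xs) + small\<close>. For the
  exactly linear field the equation can be solved over one off-period followed by one on-period,
  and the deviation from \<open>xs\<close> is multiplied by
  \<open>exp (lam * \<tau>) ^ 2 + \<epsilon> * (lam * \<tau>) * exp (lam * \<tau>)\<close>. The second summand comes from the
  delayed velocity, which is a solution of the uncontrolled linear equation and thus forces the
  on-period in resonance. The hypotheses on the gain say that this multiplier has modulus
  less than \<open>1\<close> (\<open>two_period_multiplier_lt_1\<close>).

  The multiplier of the nonlinear system differs from the linear one by an amount proportional to
  the relative size \<open>\<eta>\<close> of the nonlinear remainder (\<open>two_period_estimate\<close>), by
  Gronwall's inequality and the mean value theorem. Since \<open>f\<close> is
  continuously differentiable, \<open>\<eta>\<close> is as small as desired close to \<open>xs\<close>. Iteration gives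
  exponential decay of the deviation (\<open>exponential_decay_near_equilibrium\<close>), which yields both
  stability and attraction.

  Since \<open>f\<close> may grow superlinearly, solutions need not exist globally. They are therefore constructed
  for a globally Lipschitz field that coincides with \<open>f\<close> near \<open>xs\<close>
  (\<open>lipschitz_linear_perturbation_exists\<close>, \<open>global_controlled_solution_exists\<close>); the
  decay estimate confines them to the region where the two fields agree.
  Uniqueness (\<open>controlled_solution_unique\<close>) is proved for \<open>f\<close> itself, against all
  competitors, whether or not they stay near \<open>xs\<close>.
\<close>

section \<open>Ordinary differential equations on compact intervals\<close>

lemma has_integral_exp_scaled:
  fixes K a c :: real
  assumes "a \<le> c" "K > 0"
  shows "((\<lambda>s. exp (K * (s - a))) has_integral (exp (K * (c - a)) - 1) / K) {a..c}"
proof -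
  have "((\<lambda>s. exp (K * (s - a))) has_integral
        exp (K * (c - a)) / K - exp (K * (a - a)) / K) {a..c}"
    by (rule fundamental_theorem_of_calculus[OF assms(1)],
        unfold has_real_derivative_iff_has_vector_derivative[symmetric])
       (use assms in \<open>auto intro!: derivative_eq_intros\<close>)
  thus ?thesis by (simp add: diff_divide_distrib)
qed

text \<open>
  Picard's theorem on a whole compact interval. In the unknown
  \<open>w t = exp (- (K * (t - a))) * x t\<close> the Picard operator contracts the supremum norm by the
  factor \<open>L / K\<close>, which is less than \<open>1/2\<close> however long the interval is. The
  fixed point is sought among bounded continuous functions on the real line; composing with the
  projection \<open>cl\<close> onto \<open>{a..b}\<close> turns continuous functions on the interval into such functions.
\<close>
lemma lipschitz_ode_solution_exists:
  fixes F h :: "real \<Rightarrow> real" and a b u L :: real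
  assumes ab: "a \<le> b"
    and lip: "\<And>x y. \<bar>F x - F y\<bar> \<le> L * \<bar>x - y\<bar>"
    and h: "continuous_on {a..b} h"
  shows "\<exists>x. x a = u \<and> continuous_on {a..b} x \<and>
           (\<forall>t\<in>{a..b}. (x has_real_derivative F (x t) + h t) (at t within {a..b}))"
proof -
  have L: "L \<ge> 0" using lip[of 0 1] by simp
  have Fcont: "continuous_on UNIV F"
    by (rule lipschitz_on_continuous_on[where L = L])
       (auto simp: lipschitz_on_def dist_real_def L lip)
  define K where "K = 2 * L + 1"
  have K: "K > 0" "L / K \<le> 1/2" using L by (auto simp: K_def field_simps)
  define cl where "cl t = max a (min b t)" for t
  have cl: "cl t \<in> {a..b}" "t \<in> {a..b} \<Longrightarrow> cl t = t" for t
    using ab by (auto simp: cl_def)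
  define G where "G w s = F (exp (K * (s - a)) * apply_bcontfun w s) + h s" for w s
  have Gcont: "continuous_on {a..b} (G w)" for w
    unfolding G_def
    by (intro continuous_intros h continuous_on_compose2[OF Fcont]) auto
  have Gint: "G w integrable_on {a..c}" if "c \<in> {a..b}" for w c
    using that by (intro integrable_continuous_real continuous_on_subset[OF Gcont]) auto
  define g where "g w t = exp (- (K * (t - a))) * (u + integral {a..t} (G w))" for w t
  have gcont: "continuous_on {a..b} (g w)" for w
    unfolding g_def using ab
    by (intro continuous_intros indefinite_integral_continuous_1 Gint) auto
  have gcl: "(\<lambda>t. g w (cl t)) \<in> bcontfun" for w
  proof -
    have "continuous_on UNIV (\<lambda>t. g w (cl t))"
      by (rule continuous_on_compose2[OF gcont[of w], where f = cl])
         (use cl in \<open>auto simp: cl_def[abs_def] intro!: continuous_intros\<close>)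
    moreover have "bounded (range (\<lambda>t. g w (cl t)))"
      by (rule bounded_subset[OF compact_imp_bounded[OF compact_continuous_image[OF gcont[of w]]]])
         (use cl in auto)
    ultimately show ?thesis by (simp add: bcontfun_def)
  qed
  define \<Phi> where "\<Phi> w = Bcontfun (\<lambda>t. g w (cl t))" for w
  have \<Phi>: "apply_bcontfun (\<Phi> w) t = g w (cl t)" for w t
    by (simp add: \<Phi>_def Bcontfun_inverse[OF gcl])
  have contr: "dist (\<Phi> w) (\<Phi> w') \<le> 1/2 * dist w w'" for w w'
  proof (rule dist_bound)
    fix t
    define c where "c = cl t"
    have c: "a \<le> c" "c \<in> {a..b}" using cl(1)[of t] by (auto simp: c_def)
    define D where "D = dist w w'"
    have D: "D \<ge> 0" by (simp add: D_def)
    have "\<bar>integral {a..c} (G w) - integral {a..c} (G w')\<bar>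
        = norm (integral {a..c} (\<lambda>s. G w s - G w' s))"
      using c by (simp add: integral_diff Gint)
    also have "\<dots> \<le> integral {a..c} (\<lambda>s. L * D * exp (K * (s - a)))"
    proof (rule integral_norm_bound_integral)
      show "(\<lambda>s. G w s - G w' s) integrable_on {a..c}"
        using c by (intro integrable_diff Gint)
      show "(\<lambda>s. L * D * exp (K * (s - a))) integrable_on {a..c}"
        by (intro integrable_continuous_real continuous_intros)
      fix s
      have "norm (G w s - G w' s)
          \<le> L * \<bar>exp (K * (s - a)) * apply_bcontfun w s - exp (K * (s - a)) * apply_bcontfun w' s\<bar>"
        using lip by (simp add: G_def)
      also have "\<dots> = L * (exp (K * (s - a)) * dist (apply_bcontfun w s) (apply_bcontfun w' s))"
        by (simp add: dist_real_def abs_mult flip: right_diff_distrib)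
      also have "\<dots> \<le> L * (exp (K * (s - a)) * D)"
        unfolding D_def using L by (intro mult_left_mono dist_bounded) auto
      finally show "norm (G w s - G w' s) \<le> L * D * exp (K * (s - a))" by (simp add: mult_ac)
    qed
    also have "\<dots> = L * D * ((exp (K * (c - a)) - 1) / K)"
      using has_integral_exp_scaled[OF c(1) K(1)] by (simp add: integral_unique)
    also have "\<dots> \<le> L * D * (exp (K * (c - a)) / K)"
      using L D K by (intro mult_left_mono divide_right_mono) auto
    finally have *: "\<bar>integral {a..c} (G w) - integral {a..c} (G w')\<bar>
        \<le> L / K * D * exp (K * (c - a))" by (simp add: mult_ac)
    have "dist (apply_bcontfun (\<Phi> w) t) (apply_bcontfun (\<Phi> w') t)
        = exp (- (K * (c - a))) * \<bar>integral {a..c} (G w) - integral {a..c} (G w')\<bar>"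
      by (simp add: \<Phi> g_def dist_real_def abs_mult flip: c_def right_diff_distrib)
    also have "\<dots> \<le> exp (- (K * (c - a))) * (L / K * D * exp (K * (c - a)))"
      by (intro mult_left_mono *) auto
    also have "\<dots> = L / K * D"
      by (simp add: exp_minus)
    also have "\<dots> \<le> 1/2 * D"
      using K(2) D by (intro mult_right_mono) auto
    finally show "dist (apply_bcontfun (\<Phi> w) t) (apply_bcontfun (\<Phi> w') t) \<le> 1/2 * dist w w'"
      by (simp add: D_def)
  qed
  obtain w where w: "\<Phi> w = w"
    using banach_fix_type[of "1/2" \<Phi>] contr by auto
  define x where "x t = u + integral {a..t} (G w)" for t
  \<comment> \<open>Undoing the weight turns the fixed point equation into the integral equation for \<open>x\<close>.\<close>
  have xw: "exp (K * (t - a)) * apply_bcontfun w t = x t" if "t \<in> {a..b}" for t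
  proof -
    have "apply_bcontfun w t = exp (- (K * (t - a))) * x t"
      using \<Phi>[of w t] cl(2)[OF that] by (simp add: w g_def x_def)
    thus ?thesis by (simp add: exp_minus)
  qed
  have "x a = u" by (simp add: x_def)
  moreover have "continuous_on {a..b} x"
    unfolding x_def using ab
    by (intro continuous_intros indefinite_integral_continuous_1 Gint) auto
  moreover have "(x has_real_derivative F (x t) + h t) (at t within {a..b})"
    if t: "t \<in> {a..b}" for t
  proof -
    have "((\<lambda>t. integral {a..t} (G w)) has_real_derivative G w t) (at t within {a..b})"
      by (rule integral_has_real_derivative[OF Gcont t])
    hence "(x has_real_derivative G w t) (at t within {a..b})"
      unfolding x_def by (auto intro!: derivative_eq_intros)
    thus ?thesis using xw[OF t] by (simp add: G_def)
  qed
  ultimately show ?thesis by blast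
qed

text \<open>
  A Gronwall inequality. Squaring removes the non-differentiability of \<open>\<bar>z t\<bar>\<close> at its
  zeros: since \<open>2 * \<bar>z t\<bar> * c \<le> (z t)^2 + c^2\<close>, the function \<open>(z t)^2 + c^2\<close> grows at rate at
  most \<open>2 * L + 1\<close>. Differentiability is asked for only in the interior, so that the
  switching times may be taken as endpoints.
\<close>
lemma growth_bound:
  fixes z :: "real \<Rightarrow> real" and a b c L :: real
  assumes ab: "a \<le> b" and cont: "continuous_on {a..b} z"
    and L: "L \<ge> 0" and c: "c \<ge> 0"
    and der: "\<And>t. a < t \<Longrightarrow> t < b \<Longrightarrow>
                \<exists>d. (z has_real_derivative d) (at t) \<and> \<bar>d\<bar> \<le> L * \<bar>z t\<bar> + c"
  shows "\<bar>z b\<bar> \<le> (\<bar>z a\<bar> + c) * exp ((L + 1) * (b - a))"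
proof -
  define S where "S t = ((z t)\<^sup>2 + c\<^sup>2) * exp (- ((2 * L + 1) * (t - a)))" for t
  have "S b \<le> S a"
  proof (rule DERIV_nonpos_imp_decreasing_open[OF ab])
    show "continuous_on {a..b} S"
      unfolding S_def by (intro continuous_intros cont)
    fix t assume "a < t" "t < b"
    from der[OF this] obtain d where
      d: "(z has_real_derivative d) (at t)" "\<bar>d\<bar> \<le> L * \<bar>z t\<bar> + c" by blast
    have "2 * z t * d \<le> 2 * (\<bar>z t\<bar> * \<bar>d\<bar>)"
      using abs_ge_self[of "z t * d"] by (simp add: abs_mult)
    also have "\<dots> \<le> 2 * (\<bar>z t\<bar> * (L * \<bar>z t\<bar> + c))"
      using d(2) by (intro mult_left_mono) auto
    also have "\<dots> = 2 * L * (z t)\<^sup>2 + 2 * \<bar>z t\<bar> * c"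
      by (simp add: algebra_simps power2_eq_square flip: abs_mult)
    also have "2 * \<bar>z t\<bar> * c \<le> (z t)\<^sup>2 + c\<^sup>2"
      using sum_squares_bound[of "\<bar>z t\<bar>" c] by simp
    finally have *: "2 * z t * d \<le> 2 * L * (z t)\<^sup>2 + ((z t)\<^sup>2 + c\<^sup>2)" by simp
    have "2 * z t * d - (2 * L + 1) * ((z t)\<^sup>2 + c\<^sup>2) \<le> 0"
      using * mult_nonneg_nonneg[OF L zero_le_power2[of c]] by (simp add: algebra_simps)
    hence "(2 * z t * d - (2 * L + 1) * ((z t)\<^sup>2 + c\<^sup>2)) * exp (- ((2 * L + 1) * (t - a))) \<le> 0"
      by (intro mult_nonpos_nonneg) auto
    moreover have "(S has_real_derivative
        (2 * z t * d - (2 * L + 1) * ((z t)\<^sup>2 + c\<^sup>2)) * exp (- ((2 * L + 1) * (t - a)))) (at t)"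
      unfolding S_def by (auto intro!: derivative_eq_intros d(1) simp: algebra_simps)
    ultimately show "\<exists>y. (S has_real_derivative y) (at t) \<and> y \<le> 0" by blast
  qed
  hence "((z b)\<^sup>2 + c\<^sup>2) * exp (- ((2 * L + 1) * (b - a))) * exp ((2 * L + 1) * (b - a))
      \<le> ((z a)\<^sup>2 + c\<^sup>2) * exp ((2 * L + 1) * (b - a))"
    by (intro mult_right_mono) (auto simp: S_def)
  hence "(z b)\<^sup>2 + c\<^sup>2 \<le> ((z a)\<^sup>2 + c\<^sup>2) * exp ((2 * L + 1) * (b - a))"
    by (simp only: mult.assoc flip: exp_add) simp
  hence "(z b)\<^sup>2 \<le> ((z a)\<^sup>2 + c\<^sup>2) * exp ((2 * L + 1) * (b - a))"
    using zero_le_power2[of c] by linarith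
  also have "\<dots> \<le> (\<bar>z a\<bar> + c)\<^sup>2 * exp (2 * ((L + 1) * (b - a)))"
    using ab c by (intro mult_mono) (auto simp: power2_sum algebra_simps)
  also have "\<dots> = ((\<bar>z a\<bar> + c) * exp ((L + 1) * (b - a)))\<^sup>2"
    by (simp add: power_mult_distrib exp_double)
  finally show ?thesis
    using abs_le_square_iff[of "z b" "(\<bar>z a\<bar> + c) * exp ((L + 1) * (b - a))"] c by simp
qed

lemma drift_bound:
  fixes p :: "real \<Rightarrow> real"
  assumes ab: "a \<le> b" and cont: "continuous_on {a..b} p"
    and der: "\<And>t. a < t \<Longrightarrow> t < b \<Longrightarrow> \<exists>d. (p has_real_derivative d) (at t) \<and> \<bar>d\<bar> \<le> B"
  shows "\<bar>p b - p a\<bar> \<le> B * (b - a)"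
proof (cases "a = b")
  case False
  hence "a < b" using ab by simp
  moreover have "p differentiable (at t)" if "a < t" "t < b" for t
    using der[OF that] real_differentiable_def by blast
  ultimately obtain l s where s: "a < s" "s < b" "(p has_real_derivative l) (at s)"
      "p b - p a = (b - a) * l"
    using MVT[OF _ cont] by blast
  moreover obtain d where "(p has_real_derivative d) (at s)" "\<bar>d\<bar> \<le> B"
    using der[OF s(1,2)] by blast
  ultimately have "\<bar>l\<bar> \<le> B" using DERIV_unique by blast
  thus ?thesis using s(4) ab by (simp add: abs_mult mult.commute mult_right_mono)
qed simp

section \<open>Existence and uniqueness for the controlled system\<close>

lemma switched_gain_on_interval:
  fixes j :: nat
  assumes tau: "\<tau> > 0" and t: "t \<in> {real j * \<tau>..<(real j + 1) * \<tau>}"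
  shows "switched_gain \<epsilon> \<tau> t = (if even j then 0 else \<epsilon>)"
proof -
  have "(\<exists>k::nat. 2 * real k * \<tau> \<le> t \<and> t < (2 * real k + 1) * \<tau>) \<longleftrightarrow> even j"
  proof
    assume "even j"
    then obtain k where "j = 2 * k" by blast
    with t show "\<exists>k::nat. 2 * real k * \<tau> \<le> t \<and> t < (2 * real k + 1) * \<tau>"
      by (intro exI[of _ k]) auto
  next
    assume "\<exists>k::nat. 2 * real k * \<tau> \<le> t \<and> t < (2 * real k + 1) * \<tau>"
    then obtain k :: nat where k: "2 * real k * \<tau> \<le> t" "t < (2 * real k + 1) * \<tau>" by blast
    have "2 * real k * \<tau> < (real j + 1) * \<tau>" "real j * \<tau> < (2 * real k + 1) * \<tau>"
      using k t by auto
    hence "2 * real k < real j + 1" "real j < 2 * real k + 1"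
      using tau by auto
    hence "j = 2 * k" by linarith
    thus "even j" by simp
  qed
  thus ?thesis by (simp add: switched_gain_def)
qed

lemma switching_interval_exists:
  fixes t :: real
  assumes "\<tau> > 0" "t \<ge> 0"
  obtains j :: nat where "t \<in> {real j * \<tau>..<(real j + 1) * \<tau>}" "j = nat \<lfloor>t / \<tau>\<rfloor>"
proof
  have "real (nat \<lfloor>t / \<tau>\<rfloor>) = of_int \<lfloor>t / \<tau>\<rfloor>" using assms by simp
  thus "t \<in> {real (nat \<lfloor>t / \<tau>\<rfloor>) * \<tau>..<(real (nat \<lfloor>t / \<tau>\<rfloor>) + 1) * \<tau>}"
    using assms floor_divide_lower[of \<tau> t] floor_divide_upper[of \<tau> t] by simp
qed simp

lemma switching_interval_unique:
  fixes t :: real and j :: nat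
  assumes "\<tau> > 0" "t \<in> {real j * \<tau>..<(real j + 1) * \<tau>}"
  shows "nat \<lfloor>t / \<tau>\<rfloor> = j"
proof -
  have "\<lfloor>t / \<tau>\<rfloor> = int j"
    using assms by (intro floor_unique) (auto simp: field_simps)
  thus ?thesis by simp
qed

text \<open>
  Inside a switching interval the derivative \<open>v\<close> can be eliminated: one delay before a point of
  an on-interval lies an off-interval, where \<open>v (t - \<tau>) = f (x (t - \<tau>))\<close>. The equation is
  therefore not genuinely of neutral type but an ordinary differential equation on each interval.
\<close>
lemma controlled_solution_derivative:
  fixes j :: nat
  assumes sol: "controlled_solution f \<epsilon> \<tau> T x0 x" and tau: "\<tau> > 0"
    and t: "real j * \<tau> < t" "t < (real j + 1) * \<tau>" "ereal t < T"
  shows "(x has_real_derivative f (x t) + (if even j then 0 else \<epsilon> * f (x (t - \<tau>)))) (at t)"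
proof -
  let ?I = "\<lambda>j::nat. {real j * \<tau>..<(real j + 1) * \<tau>}"
  from sol obtain v where
    der: "\<And>j t. t \<in> ?I j \<Longrightarrow> ereal t < T \<Longrightarrow> (x has_real_derivative v t) (at t within ?I j)" and
    v: "\<And>t. 0 \<le> t \<Longrightarrow> ereal t < T \<Longrightarrow> v t = f (x t) + switched_gain \<epsilon> \<tau> t * v (t - \<tau>)"
    unfolding controlled_solution_def by blast
  have tj: "t \<in> ?I j" using t by auto
  have "0 \<le> real j * \<tau>" using tau by simp
  hence t0: "0 \<le> t" using t by linarith
  have "v t = f (x t) + (if even j then 0 else \<epsilon> * f (x (t - \<tau>)))"
  proof (cases "even j")
    case False
    then obtain i where i: "j = Suc i" "even i" by (cases j) auto
    have ti: "t - \<tau> \<in> ?I i" using t i by (auto simp: algebra_simps)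
    have "0 \<le> real i * \<tau>" using tau by simp
    hence "0 \<le> t - \<tau>" using ti by auto
    moreover have "ereal (t - \<tau>) < T"
      using t(3) tau by (meson ereal_less_eq(3) diff_le_eq le_add_same_cancel1 less_imp_le order_le_less_trans)
    ultimately have "v (t - \<tau>) = f (x (t - \<tau>))"
      using v[of "t - \<tau>"] switched_gain_on_interval[OF tau ti] i by simp
    thus ?thesis using v[OF t0 t(3)] switched_gain_on_interval[OF tau tj] False by simp
  qed (use v[OF t0 t(3)] switched_gain_on_interval[OF tau tj] in simp)
  moreover have "(x has_real_derivative v t) (at t)"
    using DERIV_subset[OF der[OF tj t(3)] greaterThanLessThan_subseteq_atLeastLessThan_iff[THEN iffD2],
        of "real j * \<tau>" "(real j + 1) * \<tau>"] t
    by (simp add: at_within_open[OF _ open_greaterThanLessThan])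
  ultimately show ?thesis by simp
qed

lemma bounded_derivative_lipschitz:
  fixes f :: "real \<Rightarrow> real"
  assumes C: "convex C" and D: "\<And>y. y \<in> C \<Longrightarrow> (f has_real_derivative D y) (at y)"
    and B: "\<And>y. y \<in> C \<Longrightarrow> \<bar>D y\<bar> \<le> B" and xy: "x \<in> C" "y \<in> C"
  shows "\<bar>f x - f y\<bar> \<le> B * \<bar>x - y\<bar>"
  using field_differentiable_bound[OF C has_field_derivative_at_within[OF D], of B x y] B xy
  by simp

text \<open>
  The two solutions agree on one switching interval after the other. Their difference vanishes
  at the start of the interval, the delayed terms coincide by induction, and \<open>f\<close> is Lipschitz
  on a compact set that contains both trajectories up to time \<open>t\<close>, so the Gronwall inequality
  applies.
\<close>
lemma controlled_solution_unique:
  fixes f D :: "real \<Rightarrow> real"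
  assumes D: "\<And>y. (f has_real_derivative D y) (at y)" and Dcont: "continuous_on UNIV D"
    and tau: "\<tau> > 0"
    and x: "controlled_solution f \<epsilon> \<tau> T x0 x" and y: "controlled_solution f \<epsilon> \<tau> T x0 y"
    and t: "0 \<le> t" "ereal t < T"
  shows "y t = x t"
proof -
  have lt: "ereal s < T" if "s \<le> t" for s
    using that t(2) by (meson ereal_less_eq(3) order_le_less_trans)
  have contx: "continuous_on {0..t} x" and conty: "continuous_on {0..t} y"
    using x y unfolding controlled_solution_def
    by (auto elim!: continuous_on_subset simp: lt)
  have "bounded (x ` {0..t} \<union> y ` {0..t})"
    using contx conty by (simp add: compact_imp_bounded compact_continuous_image)
  then obtain R where R: "\<And>z. z \<in> x ` {0..t} \<union> y ` {0..t} \<Longrightarrow> \<bar>z\<bar> \<le> R"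
    unfolding bounded_real by blast
  have "bounded (D ` {-R..R})"
    by (intro compact_imp_bounded compact_continuous_image continuous_on_subset[OF Dcont]) auto
  then obtain L where L: "\<And>z. z \<in> {-R..R} \<Longrightarrow> \<bar>D z\<bar> \<le> L"
    unfolding bounded_real by blast
  have R0: "R \<ge> 0" using R[of "x 0"] t by force
  have L0: "L \<ge> 0" using L[of 0] R0 by force
  have lip: "\<bar>f (y s) - f (x s)\<bar> \<le> L * \<bar>y s - x s\<bar>" if "0 \<le> s" "s \<le> t" for s
    by (rule bounded_derivative_lipschitz[of "{-R..R}" f D])
       (use D L R[of "x s"] R[of "y s"] that in \<open>auto simp: abs_le_iff\<close>)
  have agree: "\<forall>s\<in>{0..min t (real j * \<tau>)}. y s = x s" for j
  proof (induction j)
    case 0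
    show ?case using x y t by (auto simp: controlled_solution_def)
  next
    case (Suc j)
    show ?case
    proof
      fix s assume s: "s \<in> {0..min t (real (Suc j) * \<tau>)}"
      show "y s = x s"
      proof (cases "s \<le> real j * \<tau>")
        case True
        thus ?thesis using Suc s by auto
      next
        case False
        have j0: "0 \<le> real j * \<tau>" using tau by simp
        have start: "y (real j * \<tau>) = x (real j * \<tau>)" using Suc s False j0 by auto
        have "\<bar>y s - x s\<bar> \<le> (\<bar>y (real j * \<tau>) - x (real j * \<tau>)\<bar> + 0) * exp ((L + 1) * (s - real j * \<tau>))"
        proof (rule growth_bound)
          show "continuous_on {real j * \<tau>..s} (\<lambda>s. y s - x s)"
            by (intro continuous_intros continuous_on_subset[OF contx] continuous_on_subset[OF conty])
               (use j0 s in auto)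
          fix r assume r: "real j * \<tau> < r" "r < s"
          have "0 \<le> r" using r(1) j0 by linarith
          hence r': "r < (real j + 1) * \<tau>" "ereal r < T" "0 \<le> r" "r \<le> t"
            using r s by (auto intro!: lt simp: algebra_simps)
          have "((\<lambda>s. y s - x s) has_real_derivative f (y r) - f (x r)) (at r)"
          proof (cases "even j")
            case True
            thus ?thesis
              using controlled_solution_derivative[OF x tau r(1) r'(1,2)]
                    controlled_solution_derivative[OF y tau r(1) r'(1,2)]
              by (auto intro!: derivative_eq_intros)
          next
            case False
            hence "1 \<le> real j" by (cases j) auto
            hence "1 * \<tau> \<le> real j * \<tau>" using tau by (intro mult_right_mono) auto
            hence "0 \<le> r - \<tau>" using r(1) by linarith
            hence "y (r - \<tau>) = x (r - \<tau>)"
              using Suc.IH r s tau by (auto simp: algebra_simps)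
            thus ?thesis
              using controlled_solution_derivative[OF x tau r(1) r'(1,2)]
                    controlled_solution_derivative[OF y tau r(1) r'(1,2)] False
              by (auto intro!: derivative_eq_intros)
          qed
          thus "\<exists>d. ((\<lambda>s. y s - x s) has_real_derivative d) (at r) \<and> \<bar>d\<bar> \<le> L * \<bar>y r - x r\<bar> + 0"
            using lip[OF r'(3,4)] by auto
        qed (use False L0 in auto)
        thus ?thesis by (simp add: start)
      qed
    qed
  qed
  obtain j :: nat where "t \<in> {real j * \<tau>..<(real j + 1) * \<tau>}"
    using switching_interval_exists[OF tau t(1)] by blast
  thus ?thesis using agree[of "Suc j"] t(1) by (auto simp: algebra_simps)
qed

text \<open>
  A global Lipschitz bound excludes blow-up. The solution is assembled from pieces \<open>S j\<close> on the
  closed switching intervals \<open>I j\<close>: the delayed term of piece \<open>j + 1\<close> is a known continuous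
  function of piece \<open>j\<close>, and its initial value is the final value of piece \<open>j\<close>.
\<close>
lemma global_controlled_solution_exists:
  fixes F :: "real \<Rightarrow> real"
  assumes lip: "\<And>x y. \<bar>F x - F y\<bar> \<le> L * \<bar>x - y\<bar>" and tau: "\<tau> > 0"
  shows "\<exists>x. controlled_solution F \<epsilon> \<tau> \<infinity> x0 x"
proof -
  have L: "L \<ge> 0" using lip[of 0 1] by simp
  have Fcont: "continuous_on UNIV F"
    by (rule lipschitz_on_continuous_on[where L = L])
       (auto simp: lipschitz_on_def dist_real_def L lip)
  define I where "I j = {real j * \<tau>..(real j + 1) * \<tau>}" for j :: nat
  define gain where "gain j = (if even j then 0 else \<epsilon>)" for j :: nat
  define P where "P j s \<longleftrightarrow> continuous_on (I j) s \<and> (j = 0 \<longrightarrow> s 0 = x0 \<and>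
        (\<forall>t\<in>I 0. (s has_real_derivative F (s t)) (at t within I 0)))" for j s
  \<comment> \<open>\<open>Q j s s'\<close>: the function \<open>s'\<close> on \<open>I (Suc j)\<close> continues the function \<open>s\<close> on \<open>I j\<close>.\<close>
  define Q where "Q j s s' \<longleftrightarrow> s' ((real j + 1) * \<tau>) = s ((real j + 1) * \<tau>) \<and>
        (\<forall>t\<in>I (Suc j). (s' has_real_derivative F (s' t) + gain (Suc j) * F (s (t - \<tau>)))
             (at t within I (Suc j)))" for j s s'
  have "\<exists>S. \<forall>j. P j (S j) \<and> Q j (S j) (S (Suc j))"
  proof (rule dependent_nat_choice)
    show "\<exists>s. P 0 s"
      using lipschitz_ode_solution_exists[OF _ lip, of 0 \<tau> "\<lambda>_. 0" x0] tau
      by (auto simp: P_def I_def)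
    fix s j assume s: "P j s"
    have "continuous_on (I (Suc j)) (\<lambda>t. s (t - \<tau>))"
    proof (rule continuous_on_compose2[where g = s and t = "I j"])
      show "continuous_on (I j) s" using s by (simp add: P_def)
      show "(\<lambda>t. t - \<tau>) ` I (Suc j) \<subseteq> I j" by (auto simp: I_def algebra_simps)
    qed (intro continuous_intros)
    hence "continuous_on (I (Suc j)) (\<lambda>t. gain (Suc j) * F (s (t - \<tau>)))"
      by (intro continuous_on_mult_left continuous_on_compose2[OF Fcont]) auto
    moreover have I_Suc: "I (Suc j) = {(real j + 1) * \<tau>..(real j + 1) * \<tau> + \<tau>}"
      by (simp add: I_def algebra_simps)
    ultimately have "\<exists>s'. s' ((real j + 1) * \<tau>) = s ((real j + 1) * \<tau>) \<and>
        continuous_on (I (Suc j)) s' \<and>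
        (\<forall>t\<in>I (Suc j). (s' has_real_derivative F (s' t) + gain (Suc j) * F (s (t - \<tau>)))
             (at t within I (Suc j)))"
      unfolding I_Suc by (intro lipschitz_ode_solution_exists[where L = L] lip) (use tau in simp_all)
    thus "\<exists>s'. P (Suc j) s' \<and> Q j s s'"
      unfolding P_def Q_def by blast
  qed
  then obtain S where S: "\<And>j. P j (S j)" "\<And>j. Q j (S j) (S (Suc j))" by blast
  define x where "x t = S (nat \<lfloor>t / \<tau>\<rfloor>) t" for t
  have x_half: "x t = S j t" if "t \<in> {real j * \<tau>..<(real j + 1) * \<tau>}" for j t
    using switching_interval_unique[OF tau that] by (simp add: x_def)
  have x_eq: "x t = S j t" if "t \<in> I j" for j t
  proof (cases "t = (real j + 1) * \<tau>")
    case True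
    hence "x t = S (Suc j) t" using tau by (intro x_half) (auto simp: algebra_simps)
    thus ?thesis using S(2)[of j] True by (simp add: Q_def)
  qed (use that in \<open>auto intro!: x_half simp: I_def\<close>)
  \<comment> \<open>On finitely many intervals continuity follows by gluing; each time has a neighbourhood of this kind.\<close>
  have contN: "continuous_on {0..real j * \<tau>} x" for j
  proof (induction j)
    case (Suc j)
    have "continuous_on (I j) x"
      using S(1)[of j] x_eq by (auto simp: P_def cong: continuous_on_cong)
    hence "continuous_on ({0..real j * \<tau>} \<union> I j) x"
      using Suc by (intro continuous_on_closed_Un) (auto simp: I_def)
    moreover have "{0..real j * \<tau>} \<union> I j = {0..real (Suc j) * \<tau>}"
    proof -
      have "0 \<le> real j * \<tau>" using tau by simp
      moreover have "real j * \<tau> \<le> (real j + 1) * \<tau>" using tau by simp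
      ultimately show ?thesis
        using ivl_disj_un_two_touch(4)[of 0 "real j * \<tau>" "(real j + 1) * \<tau>"]
        by (simp add: I_def add.commute)
    qed
    ultimately show ?case by simp
  qed simp
  have cont: "continuous_on {0..} x"
    unfolding continuous_on_eq_continuous_within
  proof
    fix t :: real assume t: "t \<in> {0..}"
    obtain j :: nat where j: "t \<in> {real j * \<tau>..<(real j + 1) * \<tau>}"
      using switching_interval_exists[OF tau, of t] t by auto
    have "at t within {0..} = at t within {0..real (Suc j) * \<tau>}"
      by (rule at_within_nhd[of t "{..<real (Suc j) * \<tau>}"]) (use j in \<open>auto simp: algebra_simps\<close>)
    thus "continuous (at t within {0..}) x"
      using contN[of "Suc j"] t j by (auto simp: continuous_on_eq_continuous_within algebra_simps)
  qed
  define v where "v t = F (x t) + switched_gain \<epsilon> \<tau> t * F (x (t - \<tau>))" for t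
  have "v t = F (x t) + switched_gain \<epsilon> \<tau> t * v (t - \<tau>)" if t0: "0 \<le> t" for t
  proof -
    obtain j :: nat where j: "t \<in> {real j * \<tau>..<(real j + 1) * \<tau>}"
      using switching_interval_exists[OF tau t0] by blast
    show ?thesis
    proof (cases "even j")
      case False
      then obtain i where i: "j = Suc i" "even i" by (cases j) auto
      have "t - \<tau> \<in> {real i * \<tau>..<(real i + 1) * \<tau>}" using j i by (auto simp: algebra_simps)
      hence "v (t - \<tau>) = F (x (t - \<tau>))"
        using switched_gain_on_interval[OF tau] i by (simp add: v_def)
      thus ?thesis by (simp add: v_def)
    qed (use switched_gain_on_interval[OF tau j] in \<open>simp add: v_def\<close>)
  qed
  moreover have "(x has_real_derivative v t) (at t within {real j * \<tau>..<(real j + 1) * \<tau>})"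
    if j: "t \<in> {real j * \<tau>..<(real j + 1) * \<tau>}" for j t
  proof -
    have tI: "t \<in> I j" using j by (auto simp: I_def)
    have "(S j has_real_derivative v t) (at t within I j)"
    proof (cases j)
      case 0
      thus ?thesis using S(1)[of 0] tI x_eq[OF tI] switched_gain_on_interval[OF tau j]
        by (simp add: P_def v_def)
    next
      case (Suc i)
      have "t - \<tau> \<in> I i" using tI Suc by (auto simp: I_def algebra_simps)
      thus ?thesis using S(2)[of i] tI x_eq[OF tI] x_eq[of "t - \<tau>" i]
          switched_gain_on_interval[OF tau j, of \<epsilon>] Suc
        by (simp add: Q_def v_def gain_def)
    qed
    hence "(S j has_real_derivative v t) (at t within {real j * \<tau>..<(real j + 1) * \<tau>})"
      by (rule DERIV_subset) (auto simp: I_def)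
    thus ?thesis
      by (rule has_field_derivative_transform_within[OF _ zero_less_one j])
         (simp add: x_half)
  qed
  moreover have "x 0 = x0"
    using x_eq[of 0 0] S(1)[of 0] tau by (simp add: P_def I_def)
  moreover have "continuous_on {t. 0 \<le> t \<and> ereal t < \<infinity>} x"
    using cont by (simp add: atLeast_def)
  ultimately show ?thesis unfolding controlled_solution_def by blast
qed

lemma controlled_solution_restrict:
  assumes "controlled_solution f \<epsilon> \<tau> \<infinity> x0 x"
  shows "controlled_solution f \<epsilon> \<tau> T x0 x"
proof -
  have "continuous_on {t. 0 \<le> t \<and> ereal t < T} x" if "continuous_on {t. 0 \<le> t \<and> ereal t < \<infinity>} x"
    by (rule continuous_on_subset[OF that]) auto
  with assms show ?thesis by (auto simp: controlled_solution_def)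
qed

lemma unique_global_solutionI:
  fixes f D :: "real \<Rightarrow> real"
  assumes "\<And>y. (f has_real_derivative D y) (at y)" "continuous_on UNIV D" "\<tau> > 0"
    and "controlled_solution f \<epsilon> \<tau> \<infinity> x0 x"
  shows "unique_global_solution f \<epsilon> \<tau> x0 x"
  unfolding unique_global_solution_def
  using assms controlled_solution_unique[OF assms(1-3) controlled_solution_restrict[OF assms(4)]]
  by blast

lemma controlled_solution_cong:
  assumes sol: "controlled_solution F \<epsilon> \<tau> T x0 x"
    and eq: "\<And>t. 0 \<le> t \<Longrightarrow> ereal t < T \<Longrightarrow> F (x t) = f (x t)"
  shows "controlled_solution f \<epsilon> \<tau> T x0 x"
  using sol eq by (auto simp: controlled_solution_def)

section \<open>The two-period map\<close>

text \<open>
  Multiplying the hypotheses by \<open>s * exp s\<close> turns them into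
  \<open>- (exp s ^ 2 + 1) < \<epsilon> * s * exp s < - (exp s ^ 2 - 1)\<close>: the two hyperbolic bounds on the gain
  say precisely that the multiplier lies above \<open>-1\<close> and below \<open>1\<close>.
\<close>
lemma two_period_multiplier_lt_1:
  fixes s \<epsilon> :: real
  assumes "s > 0" "- 2 * cosh s / s < \<epsilon>" "\<epsilon> < - 2 * sinh s / s"
  shows "\<bar>exp s ^ 2 + \<epsilon> * s * exp s\<bar> < 1"
proof -
  have E: "exp s * exp (- s) = 1" by (simp flip: exp_add)
  have "- (exp s + exp (- s)) < \<epsilon> * s" "\<epsilon> * s < - (exp s - exp (- s))"
    using assms by (simp_all add: field_simps cosh_def sinh_def)
  hence "- (exp s + exp (- s)) * exp s < \<epsilon> * s * exp s"
        "\<epsilon> * s * exp s < - (exp s - exp (- s)) * exp s"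
    by (simp_all only: mult_less_cancel_right_pos[OF exp_gt_zero])
  thus ?thesis using E by (simp add: abs_less_iff algebra_simps power2_eq_square)
qed

text \<open>
  The core of the argument: the map that sends the state at the beginning of an off-period to
  the state after the following on-period, for a vector field \<open>F\<close> that is \<open>\<eta>\<close>-close to
  its linearisation. The comparison is with the linear case \<open>F y = lam * (y - xs)\<close>.
  Put \<open>E = exp (lam * \<tau>)\<close> and let \<open>u\<close> be the initial deviation. The deviation is then
  \<open>exp (lam * (t - a)) * u\<close> during the off-period. This resonates with the
  dynamics in the on-period: the delayed term contributes the inhomogeneity
  \<open>\<epsilon> * lam * exp (lam * (t - b)) * u\<close> with \<open>b = a + \<tau>\<close>, so that
  the deviation becomes \<open>exp (lam * (t - b)) * (E * u + \<epsilon> * lam * (t - b) * u)\<close>, and its value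
  at the end is \<open>(E^2 + \<epsilon> * (lam * \<tau>) * E) * u\<close>. The functions \<open>p\<close> and \<open>q\<close> below measure the
  errors in these two formulas after multiplication by the integrating factor; their derivatives
  are of order \<open>\<eta>\<close>, hence so are they.
\<close>
lemma two_period_estimate:
  fixes F x :: "real \<Rightarrow> real" and xs lam \<epsilon> \<tau> \<eta> a M :: real
  assumes lam: "lam > 0" and tau: "\<tau> > 0" and eta: "0 \<le> \<eta>" "\<eta> \<le> 1"
    and M: "M = (exp ((lam + 2) * \<tau>))\<^sup>2 * (1 + \<bar>\<epsilon>\<bar> * (lam + 1))"
    and lin: "\<And>y. \<bar>F y - lam * (y - xs)\<bar> \<le> \<eta> * \<bar>y - xs\<bar>"
    and cont: "continuous_on {a..a + 2 * \<tau>} x"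
    and off: "\<And>t. a < t \<Longrightarrow> t < a + \<tau> \<Longrightarrow> (x has_real_derivative F (x t)) (at t)"
    and on: "\<And>t. a + \<tau> < t \<Longrightarrow> t < a + 2 * \<tau> \<Longrightarrow>
               (x has_real_derivative F (x t) + \<epsilon> * F (x (t - \<tau>))) (at t)"
  shows "\<And>t. a \<le> t \<Longrightarrow> t \<le> a + 2 * \<tau> \<Longrightarrow> \<bar>x t - xs\<bar> \<le> M * \<bar>x a - xs\<bar>"
    and "\<bar>x (a + 2 * \<tau>) - xs\<bar> \<le>
           (\<bar>exp (lam * \<tau>) ^ 2 + \<epsilon> * (lam * \<tau>) * exp (lam * \<tau>)\<bar>
              + \<eta> * (exp (lam * \<tau>) ^ 2 * M * \<tau> * (2 + \<bar>\<epsilon>\<bar> + \<bar>\<epsilon>\<bar> * lam * \<tau>))) * \<bar>x a - xs\<bar>"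
proof -
  define z where "z t = x t - xs" for t
  define R where "R y = F (y + xs) - lam * y" for y
  have R: "\<bar>R y\<bar> \<le> \<eta> * \<bar>y\<bar>" for y using lin[of "y + xs"] by (simp add: R_def)
  have F: "F (x t) = lam * z t + R (z t)" for t by (simp add: R_def z_def)
  have size_F: "\<bar>lam * z t + R (z t)\<bar> \<le> (lam + 1) * \<bar>z t\<bar>" for t
  proof -
    have "\<bar>lam * z t + R (z t)\<bar> \<le> lam * \<bar>z t\<bar> + \<eta> * \<bar>z t\<bar>"
      using R[of "z t"] lam abs_triangle_ineq[of "lam * z t" "R (z t)"] by (simp add: abs_mult)
    also have "\<dots> \<le> (lam + 1) * \<bar>z t\<bar>"
      using eta mult_right_mono[of \<eta> 1 "\<bar>z t\<bar>"] by (simp add: algebra_simps)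
    finally show ?thesis .
  qed
  have zcont: "continuous_on {a..a + 2 * \<tau>} z"
    unfolding z_def by (intro continuous_intros cont)
  have zoff: "(z has_real_derivative lam * z t + R (z t)) (at t)" if "a < t" "t < a + \<tau>" for t
    using off[OF that] unfolding z_def[abs_def] F[unfolded z_def]
    by (auto intro!: derivative_eq_intros)
  have zon: "(z has_real_derivative
        lam * z t + R (z t) + \<epsilon> * (lam * z (t - \<tau>) + R (z (t - \<tau>)))) (at t)"
    if "a + \<tau> < t" "t < a + 2 * \<tau>" for t
    using on[OF that] unfolding z_def[abs_def] F[unfolded z_def]
    by (auto intro!: derivative_eq_intros)
  define d where "d = \<bar>z a\<bar>"
  have d0: "d \<ge> 0" by (simp add: d_def)
  define A where "A = exp ((lam + 2) * \<tau>)"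
  have A1: "A \<ge> 1" using lam tau by (simp add: A_def)
  have eA: "exp ((lam + 1 + 1) * s) \<le> A" if "s \<le> \<tau>" for s
    using lam mult_left_mono[OF that, of "lam + 2"] by (simp add: A_def add_ac)
  have M': "M = A * (A + \<bar>\<epsilon>\<bar> * (lam + 1) * A)"
    by (simp add: M A_def algebra_simps power2_eq_square)
  have AM: "A \<le> M"
  proof -
    have "0 \<le> \<bar>\<epsilon>\<bar> * (lam + 1) * A" using lam A1 by simp
    hence "A * 1 \<le> A * (A + \<bar>\<epsilon>\<bar> * (lam + 1) * A)" using A1 by (intro mult_left_mono) auto
    thus ?thesis by (simp add: M')
  qed
  \<comment> \<open>A priori bounds by Gronwall, first in the off-period, then in the on-period.\<close>
  have size1: "\<bar>z t\<bar> \<le> A * d" if "a \<le> t" "t \<le> a + \<tau>" for t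
  proof -
    have "\<bar>z t\<bar> \<le> (\<bar>z a\<bar> + 0) * exp ((lam + 1 + 1) * (t - a))"
    proof (rule growth_bound[OF that(1)])
      show "continuous_on {a..t} z"
        by (rule continuous_on_subset[OF zcont]) (use that tau in auto)
      fix s assume "a < s" "s < t"
      thus "\<exists>d. (z has_real_derivative d) (at s) \<and> \<bar>d\<bar> \<le> (lam + 1) * \<bar>z s\<bar> + 0"
        using zoff[of s] size_F[of s] that by auto
    qed (use lam in auto)
    also have "\<dots> \<le> d * A" unfolding d_def using eA[of "t - a"] that
      by (intro mult_mono) auto
    finally show ?thesis by (simp add: mult.commute)
  qed
  have size2: "\<bar>z t\<bar> \<le> M * d" if "a + \<tau> \<le> t" "t \<le> a + 2 * \<tau>" for t
  proof -
    have "\<bar>z t\<bar> \<le> (\<bar>z (a + \<tau>)\<bar> + \<bar>\<epsilon>\<bar> * ((lam + 1) * (A * d))) * exp ((lam + 1 + 1) * (t - (a + \<tau>)))"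
    proof (rule growth_bound[OF that(1)])
      show "continuous_on {a + \<tau>..t} z"
        by (rule continuous_on_subset[OF zcont]) (use that tau in auto)
      show "0 \<le> \<bar>\<epsilon>\<bar> * ((lam + 1) * (A * d))" using lam A1 d0 by simp
      fix s assume s: "a + \<tau> < s" "s < t"
      have "\<bar>\<epsilon> * (lam * z (s - \<tau>) + R (z (s - \<tau>)))\<bar> \<le> \<bar>\<epsilon>\<bar> * ((lam + 1) * \<bar>z (s - \<tau>)\<bar>)"
        unfolding abs_mult[of \<epsilon>] by (intro mult_left_mono size_F) auto
      also have "\<dots> \<le> \<bar>\<epsilon>\<bar> * ((lam + 1) * (A * d))"
        using s that lam by (intro mult_left_mono size1) auto
      finally have "\<bar>lam * z s + R (z s) + \<epsilon> * (lam * z (s - \<tau>) + R (z (s - \<tau>)))\<bar>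
          \<le> (lam + 1) * \<bar>z s\<bar> + \<bar>\<epsilon>\<bar> * ((lam + 1) * (A * d))"
        using size_F[of s] by linarith
      thus "\<exists>d'. (z has_real_derivative d') (at s) \<and>
              \<bar>d'\<bar> \<le> (lam + 1) * \<bar>z s\<bar> + \<bar>\<epsilon>\<bar> * ((lam + 1) * (A * d))"
        using zon[of s] s that by auto
    qed (use lam in auto)
    also have "\<dots> \<le> (A * d + \<bar>\<epsilon>\<bar> * ((lam + 1) * (A * d))) * A"
      using eA[of "t - (a + \<tau>)"] that size1[of "a + \<tau>"] tau d0 A1 lam
      by (intro mult_mono) auto
    also have "\<dots> = M * d" by (simp add: M' algebra_simps)
    finally show ?thesis .
  qed
  have size: "\<bar>z t\<bar> \<le> M * d" if "a \<le> t" "t \<le> a + 2 * \<tau>" for t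
  proof (cases "t \<le> a + \<tau>")
    case True
    have "\<bar>z t\<bar> \<le> A * d" using size1 that True by simp
    also have "\<dots> \<le> M * d" using AM d0 by (intro mult_right_mono)
    finally show ?thesis .
  qed (use size2 that in auto)
  show "\<bar>x t - xs\<bar> \<le> M * \<bar>x a - xs\<bar>" if "a \<le> t" "t \<le> a + 2 * \<tau>" for t
    using size[OF that] by (simp add: z_def d_def)
  have Md: "M * d \<ge> 0" using AM A1 d0 by simp
  have Rsize: "\<bar>R (z t)\<bar> \<le> \<eta> * (M * d)" if "a \<le> t" "t \<le> a + 2 * \<tau>" for t
    using R[of "z t"] mult_left_mono[OF size[OF that] eta(1)] by linarith
  \<comment> \<open>The error of the linear prediction in the off-period.\<close>
  define p where "p t = exp (- (lam * (t - a))) * z t - z a" for t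
  have p: "\<bar>p t\<bar> \<le> \<eta> * (M * d) * \<tau>" if t: "a \<le> t" "t \<le> a + \<tau>" for t
  proof -
    have "\<bar>p t - p a\<bar> \<le> \<eta> * (M * d) * (t - a)"
    proof (rule drift_bound[OF t(1)])
      show "continuous_on {a..t} p" unfolding p_def
        by (intro continuous_intros continuous_on_subset[OF zcont]) (use t tau in auto)
      fix s assume s: "a < s" "s < t"
      have "\<bar>exp (- (lam * (s - a))) * R (z s)\<bar> \<le> 1 * (\<eta> * (M * d))"
        unfolding abs_mult using s t tau lam
        by (intro mult_mono Rsize) auto
      moreover have "(p has_real_derivative exp (- (lam * (s - a))) * R (z s)) (at s)"
        unfolding p_def
        by (rule derivative_eq_intros zoff refl | (use s t in simp; fail))+
           (simp add: algebra_simps)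
      ultimately show "\<exists>d'. (p has_real_derivative d') (at s) \<and> \<bar>d'\<bar> \<le> \<eta> * (M * d)" by auto
    qed
    also have "\<dots> \<le> \<eta> * (M * d) * \<tau>" using t eta Md by (intro mult_left_mono) auto
    finally show ?thesis by (simp add: p_def)
  qed
  define b where "b = a + \<tau>"
  \<comment> \<open>The error of the linear prediction in the on-period, relative to the actual value \<open>z b\<close>.\<close>
  define q where "q t = exp (- (lam * (t - b))) * z t - z b - \<epsilon> * lam * (t - b) * z a" for t
  define B where "B = \<eta> * (M * d) + \<bar>\<epsilon>\<bar> * (\<eta> * (M * d)) + \<bar>\<epsilon>\<bar> * lam * (\<eta> * (M * d) * \<tau>)"
  have "\<bar>q (a + 2 * \<tau>) - q b\<bar> \<le> B * (a + 2 * \<tau> - b)"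
  proof (rule drift_bound)
    show "b \<le> a + 2 * \<tau>" using tau by (simp add: b_def)
    show "continuous_on {b..a + 2 * \<tau>} q" unfolding q_def
      by (intro continuous_intros continuous_on_subset[OF zcont]) (use tau in \<open>auto simp: b_def\<close>)
    fix s assume s: "b < s" "s < a + 2 * \<tau>"
    define e where "e = exp (- (lam * (s - b)))"
    have e: "0 \<le> e" "e \<le> 1" using s lam by (auto simp: e_def)
    let ?D = "e * R (z s) + e * (\<epsilon> * R (z (s - \<tau>))) + \<epsilon> * lam * p (s - \<tau>)"
    have "(q has_real_derivative e * (lam * z s + R (z s) + \<epsilon> * (lam * z (s - \<tau>) + R (z (s - \<tau>))))
             - lam * e * z s - \<epsilon> * lam * z a) (at s)"
      unfolding q_def e_def
      by (rule derivative_eq_intros zon refl | (use s in \<open>simp add: b_def; fail\<close>))+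
    also have "e * (lam * z s + R (z s) + \<epsilon> * (lam * z (s - \<tau>) + R (z (s - \<tau>))))
             - lam * e * z s - \<epsilon> * lam * z a = ?D"
      by (simp add: p_def e_def b_def algebra_simps)
    finally have "(q has_real_derivative ?D) (at s)" .
    moreover have "\<bar>e * R (z s)\<bar> \<le> 1 * (\<eta> * (M * d))"
      unfolding abs_mult using s e tau by (intro mult_mono Rsize) (auto simp: b_def)
    moreover have "\<bar>e * (\<epsilon> * R (z (s - \<tau>)))\<bar> \<le> 1 * (\<bar>\<epsilon>\<bar> * (\<eta> * (M * d)))"
      unfolding abs_mult using s e tau by (intro mult_mono Rsize) (auto simp: b_def)
    moreover have "\<bar>\<epsilon> * lam * p (s - \<tau>)\<bar> \<le> \<bar>\<epsilon>\<bar> * lam * (\<eta> * (M * d) * \<tau>)"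
      unfolding abs_mult using s lam tau by (intro mult_mono p) (auto simp: b_def)
    ultimately have "(q has_real_derivative ?D) (at s)" "\<bar>?D\<bar> \<le> B"
      unfolding B_def by linarith+
    thus "\<exists>d'. (q has_real_derivative d') (at s) \<and> \<bar>d'\<bar> \<le> B" by blast
  qed
  hence q: "\<bar>q (a + 2 * \<tau>)\<bar> \<le> B * \<tau>" by (simp add: q_def b_def)
  define E where "E = exp (lam * \<tau>)"
  have E1: "E \<ge> 1" using lam tau by (simp add: E_def)
  have zb: "z b = E * (z a + p b)"
    by (simp add: p_def b_def E_def exp_minus)
  have "z (a + 2 * \<tau>) = E * (z b + \<epsilon> * lam * \<tau> * z a + q (a + 2 * \<tau>))"
    by (simp add: q_def b_def E_def exp_minus)
  also have "\<dots> = (E ^ 2 + \<epsilon> * (lam * \<tau>) * E) * z a + (E ^ 2 * p b + E * q (a + 2 * \<tau>))"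
    by (simp add: zb algebra_simps power2_eq_square)
  finally have "\<bar>z (a + 2 * \<tau>)\<bar> \<le> \<bar>E ^ 2 + \<epsilon> * (lam * \<tau>) * E\<bar> * d
       + (\<bar>E ^ 2 * p b\<bar> + \<bar>E * q (a + 2 * \<tau>)\<bar>)"
    unfolding d_def abs_mult[of _ "z a", symmetric] by linarith
  also have "\<bar>E ^ 2 * p b\<bar> \<le> E ^ 2 * (\<eta> * (M * d) * \<tau>)"
    unfolding abs_mult using p[of b] tau by (intro mult_mono) (auto simp: b_def)
  also have "\<bar>E * q (a + 2 * \<tau>)\<bar> \<le> E ^ 2 * (B * \<tau>)"
    unfolding abs_mult using q E1 by (intro mult_mono) (auto simp: power2_eq_square)
  also have "\<bar>E ^ 2 + \<epsilon> * (lam * \<tau>) * E\<bar> * d + (E ^ 2 * (\<eta> * (M * d) * \<tau>) + E ^ 2 * (B * \<tau>))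
     = (\<bar>E ^ 2 + \<epsilon> * (lam * \<tau>) * E\<bar> + \<eta> * (E ^ 2 * M * \<tau> * (2 + \<bar>\<epsilon>\<bar> + \<bar>\<epsilon>\<bar> * lam * \<tau>))) * d"
    by (simp add: B_def algebra_simps)
  finally show "\<bar>x (a + 2 * \<tau>) - xs\<bar> \<le>
           (\<bar>exp (lam * \<tau>) ^ 2 + \<epsilon> * (lam * \<tau>) * exp (lam * \<tau>)\<bar>
              + \<eta> * (exp (lam * \<tau>) ^ 2 * M * \<tau> * (2 + \<bar>\<epsilon>\<bar> + \<bar>\<epsilon>\<bar> * lam * \<tau>))) * \<bar>x a - xs\<bar>"
    by (simp add: E_def d_def z_def)
qed

section \<open>Asymptotic stability\<close>

text \<open>
  Only the nonlinear remainder \<open>g\<close> is frozen outside the interval of radius \<open>\<rho>\<close>, while the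
  linear part is kept. In this way \<open>F\<close> is globally Lipschitz and at the same time
  \<open>\<eta>\<close>-close to the linearisation on the whole line, so that the two-period estimate can be
  iterated without first proving that the trajectory stays near \<open>xs\<close>.
\<close>
lemma lipschitz_linear_perturbation_exists:
  fixes f D :: "real \<Rightarrow> real"
  assumes D: "\<And>y. (f has_real_derivative D y) (at y)" and Dcont: "continuous_on UNIV D"
    and fxs: "f xs = 0" and eta: "\<eta> > 0" and lam: "D xs > 0"
  shows "\<exists>\<rho> F L. \<rho> > 0 \<and> (\<forall>x y. \<bar>F x - F y\<bar> \<le> L * \<bar>x - y\<bar>)
      \<and> (\<forall>y. \<bar>F y - D xs * (y - xs)\<bar> \<le> \<eta> * \<bar>y - xs\<bar>)
      \<and> (\<forall>y. \<bar>y - xs\<bar> \<le> \<rho> \<longrightarrow> F y = f y)"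
proof -
  have "\<exists>d>0. \<forall>y. dist y xs < d \<longrightarrow> dist (D y) (D xs) < \<eta>"
    using Dcont eta unfolding continuous_on_iff by auto
  then obtain d where d: "d > 0" "\<And>y. dist y xs < d \<Longrightarrow> dist (D y) (D xs) < \<eta>" by blast
  define \<rho> where "\<rho> = d / 2"
  have rho: "\<rho> > 0" using d by (simp add: \<rho>_def)
  have near: "\<bar>D y - D xs\<bar> \<le> \<eta>" if "y \<in> {xs - \<rho>..xs + \<rho>}" for y
  proof -
    have "dist y xs < d" using that d(1) by (auto simp: dist_real_def \<rho>_def)
    thus ?thesis using d(2)[of y] by (simp add: dist_real_def)
  qed
  define g where "g y = f y - D xs * (y - xs)" for y
  have g: "\<bar>g x - g y\<bar> \<le> \<eta> * \<bar>x - y\<bar>"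
    if "x \<in> {xs - \<rho>..xs + \<rho>}" "y \<in> {xs - \<rho>..xs + \<rho>}" for x y
  proof (rule bounded_derivative_lipschitz[OF _ _ near that])
    show "(g has_real_derivative D y - D xs) (at y)" for y
      unfolding g_def by (auto intro!: derivative_eq_intros D)
  qed auto
  define c where "c y = max (xs - \<rho>) (min (xs + \<rho>) y)" for y
  have c: "c y \<in> {xs - \<rho>..xs + \<rho>}" "\<bar>c x - c y\<bar> \<le> \<bar>x - y\<bar>" "c xs = xs" for x y
    using rho by (auto simp: c_def)
  define F where "F y = D xs * (y - xs) + g (c y)" for y
  have gc: "\<bar>g (c x) - g (c y)\<bar> \<le> \<eta> * \<bar>x - y\<bar>" for x y
    using g[OF c(1) c(1), of x y] mult_left_mono[OF c(2)[of x y], of \<eta>] eta by linarith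
  have "\<bar>F x - F y\<bar> \<le> (D xs + \<eta>) * \<bar>x - y\<bar>" for x y
  proof -
    have "\<bar>D xs * (x - y)\<bar> = D xs * \<bar>x - y\<bar>" using lam by (simp add: abs_mult)
    moreover have "F x - F y = D xs * (x - y) + (g (c x) - g (c y))"
      by (simp add: F_def algebra_simps)
    ultimately show ?thesis using gc[of x y] by (simp add: distrib_right)
  qed
  moreover have "\<bar>F y - D xs * (y - xs)\<bar> \<le> \<eta> * \<bar>y - xs\<bar>" for y
    using gc[of y xs] fxs by (simp add: F_def c g_def)
  moreover have "F y = f y" if "\<bar>y - xs\<bar> \<le> \<rho>" for y
  proof -
    have "c y = y" using that by (auto simp: c_def abs_le_iff)
    thus ?thesis by (simp add: F_def g_def)
  qed
  ultimately show ?thesis using rho by blast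
qed

text \<open>
  With \<open>\<eta>\<close> so small that \<open>q = m + \<eta> * C < 1\<close>, where \<open>m\<close> is the modulus of the linear
  multiplier, an off-period and the following on-period together shrink the deviation by
  the factor \<open>q\<close>. The exponent counts the completed pairs of this kind, and \<open>M\<close> bounds the
  growth inside a pair. The
  solution for the modified vector field \<open>F\<close> hence stays in the region where \<open>F = f\<close>, provided
  that the initial deviation is at most \<open>\<rho> / M\<close>, and is therefore a solution for \<open>f\<close>.
\<close>
lemma exponential_decay_near_equilibrium:
  fixes f D :: "real \<Rightarrow> real"
  assumes D: "\<And>y. (f has_real_derivative D y) (at y)" and Dcont: "continuous_on UNIV D"
    and fxs: "f xs = 0" and lam: "D xs > 0" and tau: "\<tau> > 0"
    and mult: "\<bar>exp (D xs * \<tau>) ^ 2 + \<epsilon> * (D xs * \<tau>) * exp (D xs * \<tau>)\<bar> < 1"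
  obtains \<delta> M q where "\<delta> > 0" "M > 0" "0 \<le> q" "q < 1"
    "\<And>x0. \<bar>x0 - xs\<bar> \<le> \<delta> \<Longrightarrow> \<exists>x. unique_global_solution f \<epsilon> \<tau> x0 x \<and>
        (\<forall>t\<ge>0. \<bar>x t - xs\<bar> \<le> M * q ^ nat \<lfloor>t / (2 * \<tau>)\<rfloor> * \<bar>x0 - xs\<bar>)"
proof -
  define lam where "lam = D xs"
  define m where "m = \<bar>exp (lam * \<tau>) ^ 2 + \<epsilon> * (lam * \<tau>) * exp (lam * \<tau>)\<bar>"
  have m: "0 \<le> m" "m < 1" using mult by (simp_all add: m_def lam_def)
  have lam0: "lam > 0" using lam by (simp add: lam_def)
  define M where "M = (exp ((lam + 2) * \<tau>))\<^sup>2 * (1 + \<bar>\<epsilon>\<bar> * (lam + 1))"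
  have M: "M > 0" unfolding M_def using lam0
    by (intro mult_pos_pos zero_less_power add_pos_nonneg) auto
  define C where "C = exp (lam * \<tau>) ^ 2 * M * \<tau> * (2 + \<bar>\<epsilon>\<bar> + \<bar>\<epsilon>\<bar> * lam * \<tau>)"
  have C: "C \<ge> 0" unfolding C_def using M lam0 tau by simp
  define \<eta> where "\<eta> = min 1 ((1 - m) / (2 * (C + 1)))"
  have eta: "\<eta> > 0" "\<eta> \<le> 1" using m C by (auto simp: \<eta>_def)
  have "\<eta> * C \<le> (1 - m) / (2 * (C + 1)) * (C + 1)"
    using eta C by (intro mult_mono) (auto simp: \<eta>_def)
  also have "\<dots> = (1 - m) / 2" using C by (simp add: field_simps)
  finally have etaC: "\<eta> * C \<le> (1 - m) / 2" .
  define q where "q = m + \<eta> * C"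
  have q: "0 \<le> q" "q < 1" using etaC m eta C by (auto simp: q_def)
  obtain \<rho> F L where rho: "\<rho> > 0" and lip: "\<And>x y. \<bar>F x - F y\<bar> \<le> L * \<bar>x - y\<bar>"
    and lin: "\<And>y. \<bar>F y - lam * (y - xs)\<bar> \<le> \<eta> * \<bar>y - xs\<bar>"
    and Ff: "\<And>y. \<bar>y - xs\<bar> \<le> \<rho> \<Longrightarrow> F y = f y"
    using lipschitz_linear_perturbation_exists[OF D Dcont fxs eta(1) lam] unfolding lam_def by blast
  have main: "\<exists>x. unique_global_solution f \<epsilon> \<tau> x0 x \<and>
        (\<forall>t\<ge>0. \<bar>x t - xs\<bar> \<le> M * q ^ nat \<lfloor>t / (2 * \<tau>)\<rfloor> * \<bar>x0 - xs\<bar>)"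
    if x0: "\<bar>x0 - xs\<bar> \<le> \<rho> / M" for x0
  proof -
    obtain x where x: "controlled_solution F \<epsilon> \<tau> \<infinity> x0 x"
      using global_controlled_solution_exists[OF lip tau] by blast
    have start: "x 0 = x0" using x by (simp add: controlled_solution_def)
    have cont: "continuous_on {0..} x" using x by (simp add: controlled_solution_def atLeast_def)
    have block: "(\<forall>t. a \<le> t \<longrightarrow> t \<le> a + 2 * \<tau> \<longrightarrow> \<bar>x t - xs\<bar> \<le> M * \<bar>x a - xs\<bar>)
        \<and> \<bar>x (a + 2 * \<tau>) - xs\<bar> \<le> q * \<bar>x a - xs\<bar>" if a: "a = real k * (2 * \<tau>)" for a k
    proof -
      have a0: "a \<ge> 0" using a tau by simp
      have ca: "continuous_on {a..a + 2 * \<tau>} x"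
        by (rule continuous_on_subset[OF cont]) (use a0 in auto)
      have off: "(x has_real_derivative F (x t)) (at t)" if "a < t" "t < a + \<tau>" for t
        using controlled_solution_derivative[OF x tau, of "2 * k" t] that a
        by (simp add: algebra_simps)
      have on: "(x has_real_derivative F (x t) + \<epsilon> * F (x (t - \<tau>))) (at t)"
        if "a + \<tau> < t" "t < a + 2 * \<tau>" for t
        using controlled_solution_derivative[OF x tau, of "2 * k + 1" t] that a
        by (simp add: algebra_simps)
      note est = two_period_estimate[OF lam0 tau less_imp_le[OF eta(1)] eta(2) M_def lin ca off on]
      show ?thesis using est(1) est(2) by (auto simp: q_def m_def C_def)
    qed
    have decay: "\<bar>x (real k * (2 * \<tau>)) - xs\<bar> \<le> q ^ k * \<bar>x0 - xs\<bar>" for k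
    proof (induction k)
      case (Suc k)
      have "\<bar>x (real (Suc k) * (2 * \<tau>)) - xs\<bar> \<le> q * \<bar>x (real k * (2 * \<tau>)) - xs\<bar>"
        using block[OF refl, of k] by (simp add: algebra_simps)
      also have "\<dots> \<le> q * (q ^ k * \<bar>x0 - xs\<bar>)"
        using Suc q by (intro mult_left_mono) auto
      finally show ?case by simp
    qed (simp add: start)
    have bound: "\<bar>x t - xs\<bar> \<le> M * q ^ nat \<lfloor>t / (2 * \<tau>)\<rfloor> * \<bar>x0 - xs\<bar>" if t: "t \<ge> 0" for t
    proof -
      obtain k :: nat where k: "t \<in> {real k * (2 * \<tau>)..<(real k + 1) * (2 * \<tau>)}"
          "k = nat \<lfloor>t / (2 * \<tau>)\<rfloor>"
        using switching_interval_exists[of "2 * \<tau>" t] tau t by auto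
      have "\<bar>x t - xs\<bar> \<le> M * \<bar>x (real k * (2 * \<tau>)) - xs\<bar>"
        using block[OF refl, of k] k(1) by (auto simp: algebra_simps)
      also have "\<dots> \<le> M * (q ^ k * \<bar>x0 - xs\<bar>)"
        using decay M by (intro mult_left_mono) auto
      finally show ?thesis by (simp add: k(2) mult.assoc)
    qed
    have "\<bar>x t - xs\<bar> \<le> \<rho>" if "t \<ge> 0" for t
    proof -
      have "q ^ nat \<lfloor>t / (2 * \<tau>)\<rfloor> \<le> 1" using q by (intro power_le_one) auto
      hence "M * q ^ nat \<lfloor>t / (2 * \<tau>)\<rfloor> * \<bar>x0 - xs\<bar> \<le> M * 1 * (\<rho> / M)"
        using M q x0 by (intro mult_mono) auto
      with bound[OF that] M show ?thesis by simp
    qed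
    hence "controlled_solution f \<epsilon> \<tau> \<infinity> x0 x"
      by (intro controlled_solution_cong[OF x] Ff)
    hence "unique_global_solution f \<epsilon> \<tau> x0 x"
      by (rule unique_global_solutionI[OF D Dcont tau])
    with bound show ?thesis by blast
  qed
  have "\<rho> / M > 0" using rho M by simp
  from that[OF this M q main] show thesis .
qed

theorem proposition1:
  fixes f :: "real \<Rightarrow> real" and xs lam \<epsilon> \<tau> :: real
  assumes "f C1_differentiable_on UNIV"
    and "f xs = 0"
    and "deriv f xs = lam"
    and "lam > 0"
    and "\<tau> > 0"
    and "- 2 * cosh (lam * \<tau>) / (lam * \<tau>) < \<epsilon>"
    and "\<epsilon> < - 2 * sinh (lam * \<tau>) / (lam * \<tau>)"
  shows "equilibrium f \<epsilon> \<tau> xs \<and> asymptotically_stable f \<epsilon> \<tau> xs"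
proof
  show "equilibrium f \<epsilon> \<tau> xs"
    unfolding equilibrium_def controlled_solution_def using assms(2)
    by (auto intro!: exI[of _ "\<lambda>_. 0"])
next
  obtain D where D: "\<And>y. (f has_real_derivative D y) (at y)" and Dcont: "continuous_on UNIV D"
    using assms(1)
    by (auto simp: C1_differentiable_on_def has_real_derivative_iff_has_vector_derivative)
  have Dxs: "D xs = lam" using DERIV_imp_deriv[OF D] assms(3) by simp
  have "\<bar>exp (lam * \<tau>) ^ 2 + \<epsilon> * (lam * \<tau>) * exp (lam * \<tau>)\<bar> < 1"
    using two_period_multiplier_lt_1 assms by simp
  then obtain \<delta> M q where M: "\<delta> > 0" "M > 0" and q: "0 \<le> q" "q < 1" and
    decay: "\<And>x0. \<bar>x0 - xs\<bar> \<le> \<delta> \<Longrightarrow> \<exists>x. unique_global_solution f \<epsilon> \<tau> x0 x \<and>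
        (\<forall>t\<ge>0. \<bar>x t - xs\<bar> \<le> M * q ^ nat \<lfloor>t / (2 * \<tau>)\<rfloor> * \<bar>x0 - xs\<bar>)"
    using exponential_decay_near_equilibrium[OF D Dcont assms(2) _ assms(5)] assms(4) Dxs by metis
  have stable: "\<exists>\<delta>>0. \<forall>x0. \<bar>x0 - xs\<bar> < \<delta> \<longrightarrow>
        (\<exists>x. unique_global_solution f \<epsilon> \<tau> x0 x \<and> (\<forall>t\<ge>0. \<bar>x t - xs\<bar> < \<Delta>))" if "\<Delta> > 0" for \<Delta>
  proof (rule exI[of _ "min \<delta> (\<Delta> / M)"], intro conjI allI impI)
    show "min \<delta> (\<Delta> / M) > 0" using M that by simp
    fix x0 assume x0: "\<bar>x0 - xs\<bar> < min \<delta> (\<Delta> / M)"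
    then obtain x where x: "unique_global_solution f \<epsilon> \<tau> x0 x"
      "\<And>t. t \<ge> 0 \<Longrightarrow> \<bar>x t - xs\<bar> \<le> M * q ^ nat \<lfloor>t / (2 * \<tau>)\<rfloor> * \<bar>x0 - xs\<bar>"
      using decay[of x0] by auto
    have "\<bar>x t - xs\<bar> < \<Delta>" if "t \<ge> 0" for t
    proof -
      have "q ^ nat \<lfloor>t / (2 * \<tau>)\<rfloor> \<le> 1" using q by (intro power_le_one) auto
      hence "M * q ^ nat \<lfloor>t / (2 * \<tau>)\<rfloor> * \<bar>x0 - xs\<bar> \<le> M * 1 * \<bar>x0 - xs\<bar>"
        using M q by (intro mult_mono) auto
      also have "\<dots> < \<Delta>" using x0 M by (simp add: field_simps)
      finally show ?thesis using x(2)[OF that] by linarith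
    qed
    with x(1) show "\<exists>x. unique_global_solution f \<epsilon> \<tau> x0 x \<and> (\<forall>t\<ge>0. \<bar>x t - xs\<bar> < \<Delta>)" by blast
  qed
  have attractive: "\<exists>x. unique_global_solution f \<epsilon> \<tau> x0 x \<and> (x \<longlongrightarrow> xs) at_top"
    if "\<bar>x0 - xs\<bar> < \<delta>" for x0
  proof -
    obtain x where x: "unique_global_solution f \<epsilon> \<tau> x0 x"
      "\<And>t. t \<ge> 0 \<Longrightarrow> \<bar>x t - xs\<bar> \<le> M * q ^ nat \<lfloor>t / (2 * \<tau>)\<rfloor> * \<bar>x0 - xs\<bar>"
      using decay[of x0] \<open>\<bar>x0 - xs\<bar> < \<delta>\<close> by auto
    have "filterlim (\<lambda>t. 1 / (2 * \<tau>) * t) at_top at_top"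
      using assms(5)
      by (intro filterlim_tendsto_pos_mult_at_top[OF tendsto_const _ filterlim_ident]) simp
    hence "filterlim (\<lambda>t. t / (2 * \<tau>)) at_top at_top" by simp
    hence "filterlim (\<lambda>t. nat \<lfloor>t / (2 * \<tau>)\<rfloor>) at_top at_top"
      by (intro filterlim_compose[OF filterlim_nat_sequentially]
            filterlim_compose[OF filterlim_floor_sequentially])
    hence "((\<lambda>t. q ^ nat \<lfloor>t / (2 * \<tau>)\<rfloor>) \<longlongrightarrow> 0) at_top"
      by (rule filterlim_compose[OF LIMSEQ_realpow_zero[OF q]])
    hence "((\<lambda>t. M * q ^ nat \<lfloor>t / (2 * \<tau>)\<rfloor> * \<bar>x0 - xs\<bar>) \<longlongrightarrow> M * 0 * \<bar>x0 - xs\<bar>) at_top"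
      by (intro tendsto_intros)
    hence "((\<lambda>t. x t - xs) \<longlongrightarrow> 0) at_top"
      by (intro Lim_null_comparison[of "\<lambda>t. x t - xs"])
         (auto intro: eventually_mono[OF eventually_ge_at_top[of 0]] x(2))
    hence "(x \<longlongrightarrow> xs) at_top" by (rule LIM_zero_cancel)
    with x(1) show ?thesis by blast
  qed
  show "asymptotically_stable f \<epsilon> \<tau> xs"
    unfolding asymptotically_stable_def using stable attractive M(1) by blast
qed

end
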